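(* For $k\ge3$ let $G_k$ be the caterpillar $[3,1,1,\dots,1,2]$ with $k$ back nodes, i.e. the tree obtained from a path $v_1v_2\cdots v_k$ by attaching $3$ leaves at $v_1$, one leaf at each of $v_2,\dots,v_{k-1}$, and $2$ leaves at $v_k$. Then $$\lim_{k\to\infty}\rho_L(G_k)=\mu_*,\qquad \mu_*=\frac{5+\sqrt{33}}{2}.$$
   Context: For a finite graph $G$, $\rho_L(G)$ is the largest eigenvalue of the Laplacian matrix $L(G)=D(G)-A(G)$. *)

theory Defs
  imports
    Complex_Main
    "Graph_Theory.Digraph_Component"
    "Jordan_Normal_Form.Char_Poly"
begin

(* A finite simple graph is a pair_graph of Graph_Theory: every edge {u, v} is represented by
   the two arcs (u, v) and (v, u), so out_degree is the degree. The rows and columns of the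
   matrices below are indexed by a list vs that enumerates the vertices. *)

definition degree_matrix :: "'a pair_pre_digraph \<Rightarrow> 'a list \<Rightarrow> real mat" where
  "degree_matrix G vs = mat (length vs) (length vs)
     (\<lambda>(i, j). if i = j then real (out_degree (with_proj G) (vs ! i)) else 0)"

definition adjacency_matrix :: "'a pair_pre_digraph \<Rightarrow> 'a list \<Rightarrow> real mat" where
  "adjacency_matrix G vs = mat (length vs) (length vs)
     (\<lambda>(i, j). if (vs ! i, vs ! j) \<in> parcs G then 1 else 0)"

definition laplacian_matrix :: "'a pair_pre_digraph \<Rightarrow> 'a list \<Rightarrow> real mat" where
  "laplacian_matrix G vs = degree_matrix G vs - adjacency_matrix G vs"

(* The choice of the enumeration does not matter, see eigenvalue_laplacian_iff. The matrix is
   real symmetric, so all its eigenvalues are real. *)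
definition rho_L :: "'a pair_pre_digraph \<Rightarrow> real" where
  "rho_L G = Max {x. eigenvalue
     (laplacian_matrix G (SOME vs. distinct vs \<and> set vs = pverts G)) x}"

datatype cat_vertex = Back nat | Leaf nat nat

(* caterpillar [c_1, ..., c_k]: a path of k back nodes with c_i leaves attached to the i-th one.
   The node v_i is Back (i - 1), and its leaves are Leaf (i - 1) j for j < c_i. *)
definition caterpillar :: "nat list \<Rightarrow> cat_vertex pair_pre_digraph" where
  "caterpillar cs = mk_symmetric (with_proj
     \<lparr> pverts = {Back i | i. i < length cs} \<union> {Leaf i j | i j. i < length cs \<and> j < cs ! i},
       parcs = {(Back i, Back (Suc i)) | i. Suc i < length cs}
             \<union> {(Back i, Leaf i j) | i j. i < length cs \<and> j < cs ! i} \<rparr>)"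

(* The caterpillar [3, 1, ..., 1, 2] with k back nodes; meaningful for k \<ge> 2 only. *)
definition cat312 :: "nat \<Rightarrow> cat_vertex pair_pre_digraph" where
  "cat312 k = caterpillar ([3] @ replicate (k - 2) 1 @ [2])"

lemma pair_graph_caterpillar: "pair_graph (caterpillar cs)"
proof -
  let ?V = "{Back i | i. i < length cs} \<union> {Leaf i j | i j. i < length cs \<and> j < cs ! i}"
  let ?A = "{(Back i, Back (Suc i)) | i. Suc i < length cs}
             \<union> {(Back i, Leaf i j) | i j. i < length cs \<and> j < cs ! i}"
  have "?V = Back ` {..<length cs} \<union> (\<lambda>(i, j). Leaf i j) ` (SIGMA i:{..<length cs}. {..<cs ! i})"
    by (auto simp: image_iff)
  then have fin: "finite ?V" by simp
  have sub: "?A \<subseteq> ?V \<times> ?V" by auto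
  have c: "pverts (caterpillar cs) = ?V" "parcs (caterpillar cs) = ?A \<union> ?A\<inverse>"
  proof -
    have "parcs (mk_symmetric (with_proj \<lparr>pverts = V, parcs = A\<rparr>)) = A \<union> A\<inverse>"
      for V :: "cat_vertex set" and A
      by (force simp: parcs_mk_symmetric)
    then show "parcs (caterpillar cs) = ?A \<union> ?A\<inverse>" unfolding caterpillar_def .
    show "pverts (caterpillar cs) = ?V" by (simp add: caterpillar_def)
  qed
  have sub': "parcs (caterpillar cs) \<subseteq> ?V \<times> ?V" using sub unfolding c by auto
  show ?thesis
  proof
    show "fst e \<in> pverts (caterpillar cs)" "snd e \<in> pverts (caterpillar cs)"
      if "e \<in> parcs (caterpillar cs)" for e
      using that sub' unfolding c(1) by auto
    show "finite (pverts (caterpillar cs))" using fin c by simp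
    show "finite (parcs (caterpillar cs))" using sub' fin finite_subset by blast
    show "fst e \<noteq> snd e" if "e \<in> parcs (caterpillar cs)" for e using that unfolding c by auto
    show "symmetric (with_proj (caterpillar cs))"
      unfolding caterpillar_def by (rule symmetric_mk_symmetric)
  qed
qed

lemma eigenvalue_laplacian_iff:
  assumes vs: "distinct vs" "set vs = pverts G"
  shows "eigenvalue (laplacian_matrix G vs) x \<longleftrightarrow>
    (\<exists>f. (\<exists>u\<in>pverts G. f u \<noteq> 0) \<and>
         (\<forall>u\<in>pverts G. real (out_degree (with_proj G) u) * f u
            - (\<Sum>w | w \<in> pverts G \<and> (u, w) \<in> parcs G. f w) = x * f u))"
proof -
  let ?n = "length vs" and ?L = "laplacian_matrix G vs"
  have bij: "bij_betw ((!) vs) {..<?n} (pverts G)"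
    using bij_betw_nth[OF vs(1) refl vs(2)[symmetric]] .
  have fin: "finite (pverts G)" using vs by (metis List.finite_set)
  have dim: "dim_row ?L = ?n" "dim_col ?L = ?n"
    by (auto simp: laplacian_matrix_def degree_matrix_def adjacency_matrix_def)
  have row: "(?L *\<^sub>v vec ?n (\<lambda>i. f (vs ! i))) $ i
      = real (out_degree (with_proj G) (vs ! i)) * f (vs ! i)
        - (\<Sum>w | w \<in> pverts G \<and> (vs ! i, w) \<in> parcs G. f w)" if i: "i < ?n" for f i
  proof -
    have "(?L *\<^sub>v vec ?n (\<lambda>i. f (vs ! i))) $ i
       = (\<Sum>j<?n. ((if i = j then real (out_degree (with_proj G) (vs ! i)) else 0)
            - (if (vs ! i, vs ! j) \<in> parcs G then 1 else 0)) * f (vs ! j))"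
      using i dim by (auto simp: scalar_prod_def laplacian_matrix_def degree_matrix_def
          adjacency_matrix_def lessThan_atLeast0 intro!: sum.cong)
    also have "\<dots> = (\<Sum>j<?n. if i = j then real (out_degree (with_proj G) (vs ! i)) * f (vs ! j) else 0)
        - (\<Sum>j<?n. if (vs ! i, vs ! j) \<in> parcs G then f (vs ! j) else 0)"
      unfolding sum_subtractf[symmetric] by (intro sum.cong) (auto simp: algebra_simps)
    also have "(\<Sum>j<?n. if i = j then real (out_degree (with_proj G) (vs ! i)) * f (vs ! j) else 0)
        = real (out_degree (with_proj G) (vs ! i)) * f (vs ! i)"
      using i by simp
    also have "(\<Sum>j<?n. if (vs ! i, vs ! j) \<in> parcs G then f (vs ! j) else 0)
        = (\<Sum>w\<in>pverts G. if (vs ! i, w) \<in> parcs G then f w else 0)"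
      using sum.reindex_bij_betw[OF bij, of "\<lambda>w. if (vs ! i, w) \<in> parcs G then f w else 0"] .
    also have "\<dots> = (\<Sum>w | w \<in> pverts G \<and> (vs ! i, w) \<in> parcs G. f w)"
      using fin by (simp add: sum.inter_filter)
    finally show ?thesis .
  qed
  have all: "(\<forall>u\<in>pverts G. P u) \<longleftrightarrow> (\<forall>i<?n. P (vs ! i))" for P
    unfolding vs(2)[symmetric] by (metis in_set_conv_nth)
  have ev: "eigenvector ?L (vec ?n (\<lambda>i. f (vs ! i))) x \<longleftrightarrow>
      (\<exists>u\<in>pverts G. f u \<noteq> 0) \<and>
         (\<forall>u\<in>pverts G. real (out_degree (with_proj G) u) * f u
            - (\<Sum>w | w \<in> pverts G \<and> (u, w) \<in> parcs G. f w) = x * f u)" for f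
  proof -
    have "vec ?n (\<lambda>i. f (vs ! i)) \<noteq> 0\<^sub>v ?n \<longleftrightarrow> \<not> (\<forall>u\<in>pverts G. f u = 0)"
      unfolding all by (auto simp: vec_eq_iff)
    moreover have "?L *\<^sub>v vec ?n (\<lambda>i. f (vs ! i)) = x \<cdot>\<^sub>v vec ?n (\<lambda>i. f (vs ! i)) \<longleftrightarrow>
      (\<forall>u\<in>pverts G. real (out_degree (with_proj G) u) * f u
            - (\<Sum>w | w \<in> pverts G \<and> (u, w) \<in> parcs G. f w) = x * f u)"
      unfolding all using row dim by (auto simp: vec_eq_iff simp del: index_mult_mat_vec)
    ultimately show ?thesis using dim by (auto simp: eigenvector_def)
  qed
  have ex: "\<exists>f. v = vec ?n (\<lambda>i. f (vs ! i))" if "v \<in> carrier_vec ?n" for v :: "real vec"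
  proof (intro exI eq_vecI)
    let ?f = "\<lambda>u. v $ (inv_into {..<?n} ((!) vs) u)"
    show "dim_vec v = dim_vec (vec ?n (\<lambda>i. ?f (vs ! i)))" using that by auto
    show "v $ i = vec ?n (\<lambda>i. ?f (vs ! i)) $ i" if "i < dim_vec (vec ?n (\<lambda>i. ?f (vs ! i)))" for i
      using that bij by (auto simp: bij_betw_def inv_into_f_f)
  qed
  have "eigenvalue ?L x \<longleftrightarrow> (\<exists>f. eigenvector ?L (vec ?n (\<lambda>i. f (vs ! i))) x)"
    unfolding eigenvalue_def using ex dim by (metis eigenvector_def)
  then show ?thesis unfolding ev .
qed

end

(* A tree is bipartite, so the Laplacian and the signless Laplacian have the same eigenvalues.
   Eliminating the leaves turns the signless eigenvalue equation into a three-term recurrence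
   b (i - 1) + b (i + 1) = s(x) b i along the back nodes, with one boundary condition at each end.
   At x = mu_* the solution that satisfies the condition at the end with 3 leaves is exactly the
   decaying one, b i = r^i with r = (mu_* - 4) / 2, and at the other end it is a strict
   supersolution: hence rho_L <= mu_*. For x slightly below mu_*, the solution has a negative
   component along the growing exponential, so for long caterpillars the boundary defect at the
   other end has the opposite sign, and the intermediate value theorem gives an eigenvalue between
   x and mu_*. *)

theory Submission
  imports Defs
begin

section \<open>Laplacian eigenvalues through functions on the vertices\<close>

lemma out_degree_eq_card_neighbours:
  assumes "pair_graph G"
  shows "out_degree (with_proj G) u = card {w. (u, w) \<in> parcs G}"
proof -
  have "out_arcs (with_proj G) u = Pair u ` {w. (u, w) \<in> parcs G}"
    by (auto simp: out_arcs_def)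
  then show ?thesis
    by (simp add: out_degree_def card_image inj_on_def)
qed

text \<open>Absorbing the degree into the sum leaves one difference per edge, and in this form a
  change of signs on one side of a bipartition turns differences into sums.\<close>

lemma eigenvalue_laplacian_iff_neighbours:
  assumes G: "pair_graph G" and vs: "distinct vs" "set vs = pverts G"
  shows "eigenvalue (laplacian_matrix G vs) x \<longleftrightarrow>
    (\<exists>f. (\<exists>u\<in>pverts G. f u \<noteq> 0) \<and>
         (\<forall>u\<in>pverts G. (\<Sum>w | (u, w) \<in> parcs G. f u - f w) = x * f u))"
proof -
  interpret pair_graph G by (rule G)
  have "{w. w \<in> pverts G \<and> (u, w) \<in> parcs G} = {w. (u, w) \<in> parcs G}" for u
    using in_arcsD2 by auto
  then show ?thesis
    unfolding eigenvalue_laplacian_iff[OF vs]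
    by (simp add: out_degree_eq_card_neighbours[OF G] sum_subtractf)
qed

lemma finite_eigenvalues:
  fixes A :: "real mat"
  assumes "A \<in> carrier_mat n n"
  shows "finite {x. eigenvalue A x}"
proof -
  have "monic (char_poly A)" using degree_monic_char_poly[OF assms] by simp
  then have "char_poly A \<noteq> 0" by auto
  then show ?thesis
    unfolding eigenvalue_root_char_poly[OF assms] by (rule poly_roots_finite)
qed

text \<open>Removes the arbitrary enumeration hidden in \<open>rho_L\<close>. Finiteness comes from
  the roots of the characteristic polynomial and is what lets \<open>Max\<close> be compared with
  its members.\<close>

lemma rho_L_eq_Max:
  assumes G: "pair_graph G"
  defines "S \<equiv> {x. \<exists>f. (\<exists>u\<in>pverts G. f u \<noteq> 0) \<and>
         (\<forall>u\<in>pverts G. (\<Sum>w | (u, w) \<in> parcs G. f u - f w) = x * f u)}"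
  shows "rho_L G = Max S" "finite S"
proof -
  interpret pair_graph G by (rule G)
  define vs where "vs = (SOME vs. distinct vs \<and> set vs = pverts G)"
  have "\<exists>vs. distinct vs \<and> set vs = pverts G"
    using finite_distinct_list[of "pverts G"] by auto
  then have "distinct vs \<and> set vs = pverts G"
    unfolding vs_def by (rule someI_ex)
  then have S: "S = {x. eigenvalue (laplacian_matrix G vs) x}"
    unfolding S_def using eigenvalue_laplacian_iff_neighbours[OF G] by auto
  then show "rho_L G = Max S" by (simp add: rho_L_def vs_def)
  have "laplacian_matrix G vs \<in> carrier_mat (length vs) (length vs)"
    by (rule carrier_matI)
      (simp_all add: laplacian_matrix_def degree_matrix_def adjacency_matrix_def)
  then show "finite S" unfolding S by (rule finite_eigenvalues)
qed

lemma rho_L_ge: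
  assumes "pair_graph G" "u \<in> pverts G" "f u \<noteq> 0"
    and "\<And>u. u \<in> pverts G \<Longrightarrow> (\<Sum>w | (u, w) \<in> parcs G. f u - f w) = x * f u"
  shows "x \<le> rho_L G"
  unfolding rho_L_eq_Max(1)[OF assms(1)]
  using assms by (intro Max_ge rho_L_eq_Max(2)) auto

text \<open>Collatz--Wielandt for the signless Laplacian, evaluated where \<open>\<bar>g u\<bar> / h u\<close> is
  largest for an eigenfunction \<open>g\<close>. The eigenvalue \<open>x\<close> is there because \<open>Max\<close> is
  unspecified on the empty set.\<close>

lemma rho_L_le:
  fixes f h :: "'a \<Rightarrow> real"
  assumes G: "pair_graph G" and x: "u \<in> pverts G" "f u \<noteq> 0"
      "\<And>u. u \<in> pverts G \<Longrightarrow> (\<Sum>w | (u, w) \<in> parcs G. f u - f w) = x * f u"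
    and pos: "\<And>u. u \<in> pverts G \<Longrightarrow> h u > 0"
    and super: "\<And>u. u \<in> pverts G \<Longrightarrow> (\<Sum>w | (u, w) \<in> parcs G. h u + h w) \<le> \<mu> * h u"
  shows "rho_L G \<le> \<mu>"
proof -
  interpret pair_graph G by (rule G)
  let ?S = "{x. \<exists>f::'a \<Rightarrow> real. (\<exists>u\<in>pverts G. f u \<noteq> 0) \<and>
      (\<forall>u\<in>pverts G. (\<Sum>w | (u, w) \<in> parcs G. f u - f w) = x * f u)}"
  have "y \<le> \<mu>" if v: "v \<in> pverts G" "g v \<noteq> 0"
    and g: "\<And>u. u \<in> pverts G \<Longrightarrow> (\<Sum>w | (u, w) \<in> parcs G. g u - g w) = y * g u"
    for y v and g :: "'a \<Rightarrow> real"
  proof -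
    let ?q = "\<lambda>u. \<bar>g u\<bar> / h u"
    have ne: "finite (?q ` pverts G)" "?q ` pverts G \<noteq> {}" using v by auto
    obtain u where u: "u \<in> pverts G" "?q u = Max (?q ` pverts G)"
      using Max_in[OF ne] by auto
    have max: "?q w \<le> ?q u" if "w \<in> pverts G" for w
      unfolding u(2) using that ne by (intro Max_ge) auto
    have le: "\<bar>g w\<bar> \<le> ?q u * h w" if "w \<in> pverts G" for w
      using max[OF that] pos[OF that] by (simp add: divide_le_eq)
    \<comment> \<open>The eigenfunction is nonzero at \<open>v\<close>, so the maximal ratio is
      positive; this permits cancelling \<open>\<bar>g u\<bar>\<close> at the end.\<close>
    have "0 < ?q v" using v pos by simp
    then have qpos: "0 < ?q u" using max[OF v(1)] by linarith
    have "y * \<bar>g u\<bar> \<le> \<bar>y * g u\<bar>" by (simp add: abs_mult mult_right_mono)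
    also have "\<dots> = \<bar>\<Sum>w | (u, w) \<in> parcs G. g u - g w\<bar>" using g[OF u(1)] by simp
    also have "\<dots> \<le> (\<Sum>w | (u, w) \<in> parcs G. \<bar>g u - g w\<bar>)" by (rule sum_abs)
    also have "\<dots> \<le> (\<Sum>w | (u, w) \<in> parcs G. ?q u * (h u + h w))"
    proof (rule sum_mono)
      fix w assume "w \<in> {w. (u, w) \<in> parcs G}"
      then have "w \<in> pverts G" using in_arcsD2 by auto
      then have "\<bar>g u\<bar> + \<bar>g w\<bar> \<le> ?q u * (h u + h w)"
        using le[OF u(1)] le[of w] by (simp only: distrib_left add_mono)
      then show "\<bar>g u - g w\<bar> \<le> ?q u * (h u + h w)" by linarith
    qed
    also have "\<dots> = ?q u * (\<Sum>w | (u, w) \<in> parcs G. h u + h w)" by (simp only: sum_distrib_left)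
    also have "\<dots> \<le> ?q u * (\<mu> * h u)" using super[OF u(1)] qpos by (intro mult_left_mono) auto
    also have "\<dots> = \<mu> * \<bar>g u\<bar>" using pos[OF u(1)] by simp
    finally show "y \<le> \<mu>" using qpos pos[OF u(1)] by (simp add: zero_less_divide_iff)
  qed
  then have "\<forall>y\<in>?S. y \<le> \<mu>" by blast
  moreover have "?S \<noteq> {}" using x by blast
  ultimately have "Max ?S \<le> \<mu>"
    using Max_le_iff[OF rho_L_eq_Max(2)[OF G]] by blast
  then show ?thesis unfolding rho_L_eq_Max(1)[OF G] .
qed

section \<open>Caterpillars and the elimination of their leaves\<close>

lemma pverts_caterpillar:
  "pverts (caterpillar cs)
    = {Back i | i. i < length cs} \<union> {Leaf i j | i j. i < length cs \<and> j < cs ! i}"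
  by (simp add: caterpillar_def)

lemma parcs_caterpillar:
  fixes cs :: "nat list"
  defines "A \<equiv> {(Back i, Back (Suc i)) | i. Suc i < length cs}
             \<union> {(Back i, Leaf i j) | i j. i < length cs \<and> j < cs ! i}"
  shows "parcs (caterpillar cs) = A \<union> A\<inverse>"
proof -
  have "parcs (mk_symmetric (with_proj \<lparr>pverts = V, parcs = A\<rparr>)) = A \<union> A\<inverse>"
    for V :: "cat_vertex set" and A
    by (force simp: parcs_mk_symmetric)
  then show ?thesis unfolding caterpillar_def A_def .
qed

lemma sum_neighbours_Back:
  fixes F :: "cat_vertex \<Rightarrow> real"
  assumes "i < length cs"
  shows "(\<Sum>w | (Back i, w) \<in> parcs (caterpillar cs). F w)
    = (if 0 < i then F (Back (i - 1)) else 0)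
      + (if Suc i < length cs then F (Back (Suc i)) else 0) + (\<Sum>j<cs ! i. F (Leaf i j))"
proof -
  let ?P = "if 0 < i then {Back (i - 1)} else {}"
  let ?N = "if Suc i < length cs then {Back (Suc i)} else {}"
  have eq: "{w. (Back i, w) \<in> parcs (caterpillar cs)} = (?P \<union> ?N) \<union> Leaf i ` {..<cs ! i}"
    using assms unfolding parcs_caterpillar by (auto split: if_splits)
  have "(\<Sum>w | (Back i, w) \<in> parcs (caterpillar cs). F w)
      = sum F (?P \<union> ?N) + sum F (Leaf i ` {..<cs ! i})"
    unfolding eq by (rule sum.union_disjoint) auto
  also have "sum F (?P \<union> ?N) = sum F ?P + sum F ?N"
    by (rule sum.union_disjoint) auto
  also have "sum F (Leaf i ` {..<cs ! i}) = (\<Sum>j<cs ! i. F (Leaf i j))"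
    by (simp add: sum.reindex inj_on_def)
  finally show ?thesis by (auto split: if_splits)
qed

lemma neighbours_Leaf:
  assumes "i < length cs" "j < cs ! i"
  shows "{w. (Leaf i j, w) \<in> parcs (caterpillar cs)} = {Back i}"
  using assms unfolding parcs_caterpillar by auto

text \<open>The defect of the signless eigenvalue equation at the back node \<open>i\<close> after its leaves
  have been eliminated: the equation at a leaf forces the value \<open>b i / (x - 1)\<close> there.\<close>

definition back_excess :: "real \<Rightarrow> nat list \<Rightarrow> (nat \<Rightarrow> real) \<Rightarrow> nat \<Rightarrow> real" where
  "back_excess x cs b i =
     (if 0 < i then b i + b (i - 1) else 0) + (if Suc i < length cs then b i + b (Suc i) else 0)
     + real (cs ! i) * (x / (x - 1) * b i) - x * b i"

text \<open>The sign \<open>(-1) ^ i\<close>, reversed at the leaves of node \<open>i\<close>, is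
  that of the bipartition: along each edge it turns a difference of \<open>f\<close> into a signed
  sum of unsigned values. A solution of the signless equation thus becomes a Laplacian
  eigenfunction.\<close>

lemma caterpillar_eigenfunction:
  fixes b :: "nat \<Rightarrow> real"
  assumes x: "x > 1" and b: "\<And>i. i < length cs \<Longrightarrow> back_excess x cs b i = 0"
    and u: "u \<in> pverts (caterpillar cs)"
  defines "f \<equiv> \<lambda>v. case v of Back i \<Rightarrow> (-1) ^ i * b i | Leaf i j \<Rightarrow> - ((-1) ^ i * b i / (x - 1))"
  shows "(\<Sum>w | (u, w) \<in> parcs (caterpillar cs). f u - f w) = x * f u"
proof (cases u)
  case (Leaf i j)
  then have "i < length cs" "j < cs ! i" using u by (auto simp: pverts_caterpillar)
  then show ?thesis using x by (simp add: Leaf neighbours_Leaf f_def field_simps)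
next
  case (Back i)
  then have i: "i < length cs" using u by (auto simp: pverts_caterpillar)
  have prev: "f (Back i) - f (Back (i - 1)) = (-1) ^ i * (b i + b (i - 1))" if "0 < i"
    using that by (cases i) (auto simp: f_def algebra_simps)
  have nxt: "f (Back i) - f (Back (Suc i)) = (-1) ^ i * (b i + b (Suc i))"
    by (auto simp: f_def algebra_simps)
  have leaf: "f (Back i) - f (Leaf i j) = (-1) ^ i * (x / (x - 1) * b i)" for j
    using x by (auto simp: f_def field_simps)
  have "(\<Sum>w | (u, w) \<in> parcs (caterpillar cs). f u - f w) - x * f u
      = (-1) ^ i * back_excess x cs b i"
    unfolding Back sum_neighbours_Back[OF i] back_excess_def
    using prev by (simp add: nxt leaf) (simp add: f_def algebra_simps)
  then show ?thesis using b[OF i] by simp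
qed

text \<open>The same extension to the leaves, without signs. Equality holds at every leaf, so the
  inequality has to be checked at the back nodes only.\<close>

lemma caterpillar_super:
  fixes b :: "nat \<Rightarrow> real"
  assumes x: "x > 1" and b: "\<And>i. i < length cs \<Longrightarrow> back_excess x cs b i \<le> 0"
    and u: "u \<in> pverts (caterpillar cs)"
  defines "f \<equiv> \<lambda>v. case v of Back i \<Rightarrow> b i | Leaf i j \<Rightarrow> b i / (x - 1)"
  shows "(\<Sum>w | (u, w) \<in> parcs (caterpillar cs). f u + f w) \<le> x * f u"
proof (cases u)
  case (Leaf i j)
  then have "i < length cs" "j < cs ! i" using u by (auto simp: pverts_caterpillar)
  then show ?thesis using x by (simp add: Leaf neighbours_Leaf f_def field_simps)
next
  case (Back i)
  then have i: "i < length cs" using u by (auto simp: pverts_caterpillar)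
  have leaf: "f (Back i) + f (Leaf i j) = x / (x - 1) * b i" for j
    using x by (auto simp: f_def field_simps)
  have "(\<Sum>w | (u, w) \<in> parcs (caterpillar cs). f u + f w) - x * f u = back_excess x cs b i"
    unfolding Back sum_neighbours_Back[OF i] back_excess_def
    by (simp add: leaf) (simp add: f_def algebra_simps)
  then show ?thesis using b[OF i] by simp
qed

lemma rho_L_caterpillar_ge:
  fixes b :: "nat \<Rightarrow> real"
  assumes "x > 1" "\<And>i. i < length cs \<Longrightarrow> back_excess x cs b i = 0"
    and "i < length cs" "b i \<noteq> 0"
  shows "x \<le> rho_L (caterpillar cs)"
  by (rule rho_L_ge[OF pair_graph_caterpillar _ _ caterpillar_eigenfunction[OF assms(1,2)],
        where u = "Back i"])
    (use assms(3,4) in \<open>auto simp: pverts_caterpillar\<close>)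

text \<open>Two parameters are in play: \<open>b\<close> solves the equations at \<open>x\<close>
  and so exhibits an eigenvalue, while \<open>h\<close> is a positive supersolution at \<mu> and
  bounds all of them.\<close>

lemma rho_L_caterpillar_le:
  fixes b h :: "nat \<Rightarrow> real"
  assumes "x > 1" "\<And>i. i < length cs \<Longrightarrow> back_excess x cs b i = 0"
    and "i < length cs" "b i \<noteq> 0"
    and "\<mu> > 1" "\<And>i. i < length cs \<Longrightarrow> back_excess \<mu> cs h i \<le> 0" "\<And>i. i < length cs \<Longrightarrow> h i > 0"
  shows "rho_L (caterpillar cs) \<le> \<mu>"
proof (rule rho_L_le[OF pair_graph_caterpillar _ _ caterpillar_eigenfunction[OF assms(1,2)]
      _ caterpillar_super[OF assms(5,6)], where u = "Back i"])
  show "0 < (case u of Back i \<Rightarrow> h i | Leaf i j \<Rightarrow> h i / (\<mu> - 1))"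
    if "u \<in> pverts (caterpillar cs)" for u
    using that assms(5,7) by (auto simp: pverts_caterpillar)
qed (use assms(3,4) in \<open>auto simp: pverts_caterpillar\<close>)

section \<open>The shooting recurrence for [3, 1, ..., 1, 2]\<close>

text \<open>Each has the form x - degree - leaves / (x - 1) for a back node. Vanishing excess forces
  \<open>b 1 / b 0\<close> at the first node, \<open>(b (i - 1) + b (i + 1)) / b i\<close> at an
  inner node and \<open>b m / b (Suc m)\<close> at the last one to take these values.\<close>

definition first_ratio :: "real \<Rightarrow> real" where "first_ratio x = x - 4 - 3 / (x - 1)"
definition mid_sum :: "real \<Rightarrow> real" where "mid_sum x = x - 3 - 1 / (x - 1)"
definition last_ratio :: "real \<Rightarrow> real" where "last_ratio x = x - 3 - 2 / (x - 1)"

text \<open>Starting from the end with 3 leaves, every equation but the one at the last back node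
  holds by construction; eigenvalues are found by matching that one.\<close>

fun shoot :: "real \<Rightarrow> nat \<Rightarrow> real" where
  "shoot x 0 = 1"
| "shoot x (Suc 0) = first_ratio x"
| "shoot x (Suc (Suc n)) = mid_sum x * shoot x (Suc n) - shoot x n"

text \<open>Here \<open>m\<close> counts the inner nodes, so the back nodes have indices 0 to
  \<open>Suc m\<close>.\<close>

abbreviation cs312 :: "nat \<Rightarrow> nat list" where
  "cs312 m \<equiv> [3] @ replicate m 1 @ [2]"

lemma back_excess_cs312:
  assumes x: "x > 1" and i: "i < length (cs312 m)"
  shows "back_excess x (cs312 m) b i
    = (if i = 0 then b (Suc 0) - first_ratio x * b 0
       else if i \<le> m then b (i - 1) + b (Suc i) - mid_sum x * b i
       else b m - last_ratio x * b (Suc m))"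
proof -
  have d: "x / (x - 1) = 1 + 1 / (x - 1)" using x by (simp add: field_simps)
  consider "i = 0" | "0 < i" "i \<le> m" | "i = Suc m" using i by force
  then show ?thesis
  proof cases
    case 1
    then show ?thesis unfolding back_excess_def d first_ratio_def by (simp add: algebra_simps)
  next
    case 2
    then have "cs312 m ! i = 1" by (cases i) (auto simp: nth_append)
    then show ?thesis using 2 unfolding back_excess_def d mid_sum_def by (simp add: algebra_simps)
  next
    case 3
    then have "cs312 m ! i = 2" by (auto simp: nth_append)
    then show ?thesis using 3 unfolding back_excess_def d last_ratio_def by (simp add: algebra_simps)
  qed
qed

lemma back_excess_shoot:
  assumes "x > 1" "last_ratio x * shoot x (Suc m) = shoot x m" "i < length (cs312 m)"
  shows "back_excess x (cs312 m) (shoot x) i = 0"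
  unfolding back_excess_cs312[OF assms(1,3)] using assms(2) by (cases i) auto

lemma continuous_on_shoot: "continuous_on {1<..} (\<lambda>x. shoot x n)"
  by (induction n rule: induct_nat_012)
    (auto intro!: continuous_intros simp: first_ratio_def mid_sum_def)

text \<open>\<open>r\<close> and \<open>R\<close> are the roots of t^2 - \<open>mid_sum x\<close> *
  t + 1, so both sides obey the same recurrence and agree at 0 and 1. For r < R the growing term has
  the sign of \<open>first_ratio x - r\<close>.\<close>

lemma shoot_closed_form:
  assumes "r + R = mid_sum x" "r * R = 1" "r \<noteq> R"
  shows "shoot x n = (first_ratio x - r) / (R - r) * R ^ n + (R - first_ratio x) / (R - r) * r ^ n"
proof (induction n rule: induct_nat_012)
  case 0
  show ?case using assms(3) by (simp flip: add_divide_distrib)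
next
  case 1
  have "(first_ratio x - r) * R + (R - first_ratio x) * r = first_ratio x * (R - r)"
    by (simp add: algebra_simps)
  then show ?case using assms(3) by (simp add: nonzero_eq_divide_eq flip: add_divide_distrib)
next
  case (ge2 n)
  have quad: "t * t = mid_sum x * t - 1" if "t = r \<or> t = R" for t
    using that assms(2) by (auto simp flip: assms(1) simp: algebra_simps)
  have rec: "t ^ Suc (Suc n) = mid_sum x * t ^ Suc n - t ^ n" if "t = r \<or> t = R" for t
  proof -
    have "t ^ Suc (Suc n) = t * t * t ^ n" by simp
    also have "\<dots> = mid_sum x * t ^ Suc n - t ^ n"
      unfolding quad[OF that] by (simp add: algebra_simps)
    finally show ?thesis .
  qed
  show ?case
    unfolding shoot.simps ge2 rec[of r, simplified] rec[of R, simplified]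
    by (simp add: rec[of r, simplified] rec[of R, simplified] algebra_simps)
qed

section \<open>The recurrence at \<mu> and just below it\<close>

context
  fixes \<mu> :: real
  assumes mu_def: "\<mu> = (5 + sqrt 33) / 2"
begin

lemma mu_bounds: "5.3 < \<mu>" "\<mu> < 5.4"
  unfolding mu_def using real_less_rsqrt[of "5.7" 33] real_less_lsqrt[of "5.8" 33]
  by (auto simp: power2_eq_square)

lemma mu_square: "\<mu> * \<mu> = 5 * \<mu> + 2"
  unfolding mu_def by (simp add: field_simps)

text \<open>By the second claim \<open>r\<close> is a characteristic root, and by the first the
  shooting starts with exactly this ratio, so it is purely geometric. The third makes the defect at
  the last node strict.\<close>

lemma ratios_mu:
  defines "r \<equiv> (\<mu> - 4) / 2"
  shows "first_ratio \<mu> = r" "mid_sum \<mu> * r = 1 + r * r" "1 < last_ratio \<mu> * r" "0 < r"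
proof -
  \<comment> \<open>By \<open>mu_square\<close>, (\<mu> - 1) * (\<mu> - 4) = 6.\<close>
  have d: "1 / (\<mu> - 1) = (\<mu> - 4) / 6"
    using mu_bounds mu_square by (simp add: field_simps)
  have d3: "3 / (\<mu> - 1) = 3 * ((\<mu> - 4) / 6)" "2 / (\<mu> - 1) = 2 * ((\<mu> - 4) / 6)"
    unfolding d[symmetric] by simp_all
  show "first_ratio \<mu> = r" unfolding first_ratio_def d3 r_def by (simp add: field_simps)
  show "mid_sum \<mu> * r = 1 + r * r" unfolding mid_sum_def d r_def
    using mu_square by (simp add: field_simps)
  show "1 < last_ratio \<mu> * r" unfolding last_ratio_def d3 r_def
    using mu_square mu_bounds by (simp add: field_simps)
  show "0 < r" unfolding r_def using mu_bounds by simp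
qed

lemma shoot_mu: "shoot \<mu> n = ((\<mu> - 4) / 2) ^ n"
proof (induction n rule: induct_nat_012)
  case (ge2 n)
  let ?r = "(\<mu> - 4) / 2"
  have "mid_sum \<mu> * ?r ^ Suc n - ?r ^ n = (mid_sum \<mu> * ?r - 1) * ?r ^ n"
    by (simp only: power_Suc) (simp add: algebra_simps)
  also have "\<dots> = ?r ^ Suc (Suc n)" unfolding ratios_mu(2) by (simp only: power_Suc) simp
  finally show ?case by (simp only: shoot.simps ge2)
qed (use ratios_mu(1) in auto)

lemma last_shoot_mu: "shoot \<mu> m < last_ratio \<mu> * shoot \<mu> (Suc m)"
proof -
  have "1 * ((\<mu> - 4) / 2) ^ m < (last_ratio \<mu> * ((\<mu> - 4) / 2)) * ((\<mu> - 4) / 2) ^ m"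
    using ratios_mu(3,4) by (intro mult_strict_right_mono) auto
  then show ?thesis unfolding shoot_mu by (simp add: mult_ac)
qed

lemma back_excess_mu:
  assumes "i < length (cs312 m)"
  shows "back_excess \<mu> (cs312 m) (shoot \<mu>) i \<le> 0"
  using mu_bounds last_shoot_mu[of m] assms
  by (subst back_excess_cs312) (auto simp: gr0_conv_Suc)

text \<open>The difference of the two sides is a combination of \<open>R ^ m\<close> and
  \<open>r ^ m\<close> with r < 1 < R. Below \<mu> the coefficient of \<open>R ^ m\<close> is
  negative, and this term eventually decides the sign.\<close>

lemma shooting_below_mu:
  assumes x: "5.3 \<le> x" "x < \<mu>"
  shows "\<forall>\<^sub>F m in sequentially. last_ratio x * shoot x (Suc m) < shoot x m"
proof -
  define s p q where "s = mid_sum x" and "p = first_ratio x" and "q = last_ratio x"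
  define d where "d = sqrt (s\<^sup>2 - 4)"
  define r R where "r = (s - d) / 2" and "R = (s + d) / 2"
  \<comment> \<open>The value at x = 5.3, where the fraction is largest. It suffices for s > 2,
    hence distinct real roots, and for q > 1.\<close>
  have inv: "1 / (x - 1) \<le> 10 / 43" using x by (simp add: field_simps)
  have s: "s > 2" using inv x unfolding s_def mid_sum_def by linarith
  have "q = x - 3 - 2 * (1 / (x - 1))" by (simp add: q_def last_ratio_def)
  then have q: "q > 1" using inv x by linarith
  have sq: "s\<^sup>2 - 4 > 0" using s power_strict_mono[of 2 s 2] by simp
  then have d: "d > 0" "d * d = s * s - 4" by (simp_all add: d_def power2_eq_square)
  have rR: "r + R = s" "r < R" using d(1) by (auto simp: r_def R_def field_simps)
  have prod: "r * R = 1" using d(2) by (simp add: r_def R_def field_simps)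
  have R: "R > 1" using s d(1) by (simp add: R_def)
  have "r = 1 / R" using prod R by (simp add: field_simps)
  then have r: "0 < r" "r < 1" using R by auto
  have neg: "x * x < 5 * x + 2"
  proof -
    have "(\<mu> - x) * (\<mu> + x - 5) > 0" using x mu_bounds by (intro mult_pos_pos) auto
    then show ?thesis using mu_square by (simp add: algebra_simps)
  qed
  have ps: "(x - 1) * p = (x - 4) * (x - 1) - 3" "(x - 1) * s = (x - 3) * (x - 1) - 1"
    using x unfolding p_def s_def first_ratio_def mid_sum_def by (simp_all add: field_simps)
  \<comment> \<open>Up to the factor (x - 1)^2, the characteristic polynomial at \<open>p\<close> is
    x * (5 * x + 2 - x * x), whose only positive zero is \<mu>.\<close>
  have "(x - 1)\<^sup>2 * (p * p - s * p + 1)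
      = ((x - 1) * p) * ((x - 1) * p) - ((x - 1) * s) * ((x - 1) * p) + (x - 1)\<^sup>2"
    by (simp add: algebra_simps power2_eq_square)
  also have "\<dots> = x * (5 * x + 2 - x * x)"
    unfolding ps by (simp add: algebra_simps power2_eq_square)
  finally have "(x - 1)\<^sup>2 * (p * p - s * p + 1) = x * (5 * x + 2 - x * x)" .
  moreover have "x * (5 * x + 2 - x * x) > 0" using x neg by (intro mult_pos_pos) auto
  ultimately have "(x - 1)\<^sup>2 * (p * p - s * p + 1) > 0" by simp
  then have "p * p - s * p + 1 > 0" by (rule zero_less_mult_pos) (use x in simp)
  then have *: "(r - p) * (R - p) > 0" using rR(1) prod by (simp add: algebra_simps flip: rR(1))
  \<comment> \<open>By the positive product, \<open>p\<close> lies below both roots or above both.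
    The bound, from x < 5.4, gives p < 1 < R and excludes the latter.\<close>
  have "1 / (x - 1) \<ge> 10 / 44" using x mu_bounds by (simp add: field_simps)
  then have "p < 1" using x mu_bounds unfolding p_def first_ratio_def by simp
  then have p: "p < r" using * R by (simp add: zero_less_mult_iff)
  define A B where "A = (p - r) / (R - r)" and "B = (R - p) / (R - r)"
  have b: "shoot x n = A * R ^ n + B * r ^ n" for n
    using shoot_closed_form[of r R x n] rR prod by (simp add: A_def B_def s_def p_def)
  have A: "A * (q * R - 1) < 0"
    using p rR(2) less_1_mult[OF q R] by (simp add: A_def mult_less_0_iff divide_less_0_iff)
  \<comment> \<open>Once \<open>R ^ m\<close> exceeds \<open>C\<close>, the negative growing term
    outweighs the decaying one, since \<open>r ^ m\<close> is at most 1.\<close>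
  define C where "C = \<bar>B * (q * r - 1)\<bar> / - (A * (q * R - 1))"
  obtain N where N: "C < R ^ N" using real_arch_pow[OF R] by blast
  have "C < R ^ m" if "N \<le> m" for m
    using N power_increasing[OF that, of R] R by linarith
  then have "\<forall>\<^sub>F m in sequentially. C < R ^ m" by (rule eventually_sequentiallyI)
  then show ?thesis
  proof eventually_elim
    case (elim m)
    have "B * (q * r - 1) * r ^ m \<le> \<bar>B * (q * r - 1)\<bar> * 1"
    proof -
      have "B * (q * r - 1) * r ^ m \<le> \<bar>B * (q * r - 1)\<bar> * r ^ m"
        using r by (intro mult_right_mono) auto
      also have "\<dots> \<le> \<bar>B * (q * r - 1)\<bar> * 1"
        using r by (intro mult_left_mono power_le_one) auto
      finally show ?thesis .
    qed
    moreover have "\<bar>B * (q * r - 1)\<bar> < R ^ m * - (A * (q * R - 1))"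
      using elim A unfolding C_def by (subst (asm) pos_divide_less_eq) simp_all
    then have "A * (q * R - 1) * R ^ m + \<bar>B * (q * r - 1)\<bar> < 0"
      by (simp add: mult.commute)
    moreover have "q * shoot x (Suc m) - shoot x m
        = A * (q * R - 1) * R ^ m + B * (q * r - 1) * r ^ m"
      unfolding b by (simp add: algebra_simps)
    ultimately show ?case unfolding q_def by linarith
  qed
qed

section \<open>Squeezing the largest eigenvalue\<close>

text \<open>The defect at the last node is negative at \<open>x\<close> and positive at \<mu>. Its
  zero in between is an eigenvalue: it gives the lower bound and also the eigenvalue that the upper
  bound requires.\<close>

lemma rho_L_cat312_bounds:
  assumes x: "5.3 \<le> x" "x < \<mu>"
    and below: "last_ratio x * shoot x (Suc m) < shoot x m"
  shows "x \<le> rho_L (cat312 (m + 2))" "rho_L (cat312 (m + 2)) \<le> \<mu>"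
proof -
  let ?F = "\<lambda>y. last_ratio y * shoot y (Suc m) - shoot y m"
  have "continuous_on {x..\<mu>} (\<lambda>y. shoot y n)" for n
    by (rule continuous_on_subset[OF continuous_on_shoot]) (use x in auto)
  then have "continuous_on {x..\<mu>} ?F"
    unfolding last_ratio_def by (intro continuous_intros) (use x in auto)
  then obtain y where y: "x \<le> y" "y \<le> \<mu>" "?F y = 0"
    using IVT'[of ?F x 0 \<mu>] x below last_shoot_mu[of m] by auto
  have cat: "cat312 (m + 2) = caterpillar (cs312 m)" by (simp add: cat312_def)
  have gt1: "y > 1" "\<mu> > 1" using x y by auto
  have "last_ratio y * shoot y (Suc m) = shoot y m" using y by simp
  note zero = back_excess_shoot[OF gt1(1) this]
  have start: "0 < length (cs312 m)" "shoot y 0 \<noteq> 0" by auto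
  have "y \<le> rho_L (caterpillar (cs312 m))"
    using rho_L_caterpillar_ge[OF gt1(1) zero start] .
  then show "x \<le> rho_L (cat312 (m + 2))" using y cat by simp
  have "shoot \<mu> i > 0" for i unfolding shoot_mu using ratios_mu(4) by simp
  then show "rho_L (cat312 (m + 2)) \<le> \<mu>"
    unfolding cat using rho_L_caterpillar_le[OF gt1(1) zero start gt1(2) back_excess_mu] by blast
qed

lemma rho_L_cat312_tendsto: "(\<lambda>k. rho_L (cat312 k)) \<longlonglongrightarrow> \<mu>"
proof -
  have bounds: "\<forall>\<^sub>F m in sequentially. x \<le> rho_L (cat312 (m + 2)) \<and> rho_L (cat312 (m + 2)) \<le> \<mu>"
    if "5.3 \<le> x" "x < \<mu>" for x
    using shooting_below_mu[OF that] by eventually_elim (use rho_L_cat312_bounds[OF that] in auto)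
  have "(\<lambda>m. rho_L (cat312 (m + 2))) \<longlonglongrightarrow> \<mu>"
  proof (rule order_tendstoI)
    fix a assume "a < \<mu>"
    \<comment> \<open>The bounds are available from 5.3 on, hence the maximum.\<close>
    then obtain x where x: "max a 5.3 < x" "x < \<mu>"
      using dense[of "max a 5.3" \<mu>] mu_bounds by auto
    then show "\<forall>\<^sub>F m in sequentially. a < rho_L (cat312 (m + 2))"
      using bounds[of x] by (auto elim!: eventually_mono)
  next
    fix a assume "\<mu> < a"
    then show "\<forall>\<^sub>F m in sequentially. rho_L (cat312 (m + 2)) < a"
      using bounds[of "5.3"] mu_bounds by (auto elim!: eventually_mono)
  qed
  \<comment> \<open>The terms k = 0 and k = 1, where \<open>k - 2\<close> is truncated, do not
    affect the limit.\<close>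
  then show ?thesis by (rule LIMSEQ_offset)
qed

end

theorem lemma3p6:
  shows "(\<lambda>k. rho_L (cat312 k)) \<longlonglongrightarrow> (5 + sqrt 33) / 2"
  by (rule rho_L_cat312_tendsto[OF refl])

end
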